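(* For every $t\in O(\log n)$ (i.e. every $t=t(n)\ge 1$ with $t(n)=O(\log n)$), we have $$\mathsf{size\text{-}pls}(\mathrm{ST},t)=O\left(\frac{\log n}{t}\right),$$ where $n$ is the number of nodes.
   Context: Predicate. Consider connected undirected weighted labeled graphs $(G,x)$ in which each label $x(v)$ contains a (possibly empty) subset of the edges incident to $v$, consistently between neighbors (an edge $\{u,v\}$ is in $x(u)$ iff it is in $x(v)$). Let $T_x$ be the set of all edges represented in $x$. The predicate $\mathrm{ST}$ holds on $(G,x)$ iff $T_x$ is a spanning tree of $G$. Edge weights of $n$-node graphs are in $[1,n^c]$ for a fixed $c\ge1$. Model. An identity assignment on a graph $G=(V,E)$ (finite, connected, simple) is an injective map $\mathrm{ID}:V\to[1,n^c]$ for some fixed $c\ge 1$, where $n=|V|$. A proof-labeling scheme (PLS) for a predicate $\mathcal{P}$ is a pair $(\mathbf{p},\mathbf{v})$, where the prover $\mathbf{p}$ assigns to every node $v$ of every instance $(G,x,\mathrm{ID})$ a bit-string called certificate, and the verifier $\mathbf{v}$ is a deterministic distributed algorithm in the LOCAL model in which every node outputs accept or reject, such that: (i) if $(G,x,\mathrm{ID})$ satisfies $\mathcal{P}$, then all nodes accept with the certificates given by $\mathbf{p}$; (ii) if $(G,x,\mathrm{ID})$ does not satisfy $\mathcal{P}$, then for every assignment of certificates to the nodes, at least one node rejects. The radius of the scheme is the maximum number of rounds of $\mathbf{v}$; a scheme of radius $t$ is one where, equivalently, each node $v$ decides from $t$, the structure of the ball of radius $t$ (in hops) around $v$, and the identities,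 labels, incident edge weights and certificates of the nodes at distance at most $t$ from $v$ (arbitrary local computation is allowed). The size of a scheme, as a function of $n$, is the maximum number of bits of a certificate assigned by $\mathbf{p}$ to a node, over all $n$-node instances satisfying $\mathcal{P}$. $\mathsf{size\text{-}pls}(\mathcal{P},t)$ is the minimum size of a PLS for $\mathcal{P}$ of radius at most $t$ on $n$-node labeled graphs. *)

theory Defs
  imports
    Complex_Main
    "HOL-Library.Multiset"
    "HOL-Library.Extended_Nat"
    "HOL-Library.Landau_Symbols"
begin

section \<open>Simple graphs and spanning trees\<close>

text \<open>Edges are two-element sets of vertices.\<close>

definition simple_graph :: "'v set \<Rightarrow> 'v set set \<Rightarrow> bool" where
  "simple_graph V E \<longleftrightarrow>
     finite V \<and> (\<forall>e\<in>E. \<exists>u\<in>V. \<exists>w\<in>V. u \<noteq> w \<and> e = {u, w})"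

definition adj :: "'v set set \<Rightarrow> ('v \<times> 'v) set" where
  "adj E = {(u, w). {u, w} \<in> E}"

definition connected_graph :: "'v set \<Rightarrow> 'v set set \<Rightarrow> bool" where
  "connected_graph V E \<longleftrightarrow> V \<noteq> {} \<and> (\<forall>u\<in>V. \<forall>w\<in>V. (u, w) \<in> (adj E)\<^sup>*)"

definition cycle :: "'v set set \<Rightarrow> 'v list \<Rightarrow> bool" where
  "cycle E xs \<longleftrightarrow>
     3 \<le> length xs \<and> distinct xs \<and>
     (\<forall>i. Suc i < length xs \<longrightarrow> {xs ! i, xs ! Suc i} \<in> E) \<and> {last xs, hd xs} \<in> E"

definition spanning_tree :: "'v set \<Rightarrow> 'v set set \<Rightarrow> 'v set set \<Rightarrow> bool" where
  "spanning_tree V E T \<longleftrightarrow> T \<subseteq> E \<and> connected_graph V T \<and> (\<nexists>xs. cycle T xs)"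

text \<open>Vertices at hop distance at most \<open>r\<close> from \<open>v\<close>.\<close>

definition hop_ball :: "'v set set \<Rightarrow> nat \<Rightarrow> 'v \<Rightarrow> 'v set" where
  "hop_ball E r v = {u. \<exists>k\<le>r. (v, u) \<in> adj E ^^ k}"

section \<open>Labeled graphs and identity assignments\<close>

record 'v lgraph =
  verts :: "'v set"
  edges :: "'v set set"
  weight :: "'v set \<Rightarrow> nat"
  label :: "'v \<Rightarrow> 'v set set"

definition valid_lgraph :: "real \<Rightarrow> 'v lgraph \<Rightarrow> bool" where
  "valid_lgraph c G \<longleftrightarrow>
     simple_graph (verts G) (edges G) \<and> connected_graph (verts G) (edges G) \<and>
     (\<forall>e\<in>edges G. 1 \<le> weight G e \<and> real (weight G e) \<le> real (card (verts G)) powr c) \<and>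
     (\<forall>v\<in>verts G. label G v \<subseteq> {e \<in> edges G. v \<in> e}) \<and>
     (\<forall>u w. {u, w} \<in> edges G \<longrightarrow> ({u, w} \<in> label G u \<longleftrightarrow> {u, w} \<in> label G w))"

definition id_assignment :: "real \<Rightarrow> 'v lgraph \<Rightarrow> ('v \<Rightarrow> nat) \<Rightarrow> bool" where
  "id_assignment c G ident \<longleftrightarrow>
     inj_on ident (verts G) \<and>
     (\<forall>v\<in>verts G. 1 \<le> ident v \<and> real (ident v) \<le> real (card (verts G)) powr c)"

definition ST :: "'v lgraph \<Rightarrow> bool" where
  "ST G \<longleftrightarrow> spanning_tree (verts G) (edges G) (\<Union>v\<in>verts G. label G v)"

section \<open>Local views\<close>

text \<open>
  A view describes a ball without revealing the names of its vertices: nodes are named by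
  their identities only. A node contributes one port for each incident edge, consisting of the
  identity of the other endpoint if that endpoint is in the ball (and \<^term>\<open>None\<close> otherwise), the
  weight of the edge, and whether the edge belongs to the label of the node.
\<close>

type_synonym port = "nat option \<times> nat \<times> bool"

type_synonym certificate = "bool list"

record node_info =
  node_id :: nat
  node_cert :: certificate
  node_ports :: "port multiset"

record view =
  centre :: nat
  nodes :: "node_info set"

definition port_of ::
  "'v lgraph \<Rightarrow> ('v \<Rightarrow> nat) \<Rightarrow> 'v set \<Rightarrow> 'v \<Rightarrow> 'v \<Rightarrow> port" where
  "port_of G ident B u w =
     (if w \<in> B then Some (ident w) else None, weight G {u, w}, {u, w} \<in> label G u)"

definition info_of ::
  "'v lgraph \<Rightarrow> ('v \<Rightarrow> nat) \<Rightarrow> ('v \<Rightarrow> certificate) \<Rightarrow> 'v set \<Rightarrow> 'v \<Rightarrow> node_info" where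
  "info_of G ident cert B u =
     \<lparr>node_id = ident u,
      node_cert = cert u,
      node_ports = image_mset (port_of G ident B u) (mset_set {w. {u, w} \<in> edges G})\<rparr>"

definition view_of ::
  "'v lgraph \<Rightarrow> ('v \<Rightarrow> nat) \<Rightarrow> ('v \<Rightarrow> certificate) \<Rightarrow> nat \<Rightarrow> 'v \<Rightarrow> view" where
  "view_of G ident cert r v =
     (let B = hop_ball (edges G) r v
      in \<lparr>centre = ident v, nodes = info_of G ident cert B ` B\<rparr>)"

section \<open>Proof-labeling schemes\<close>

type_synonym 'v prover = "'v lgraph \<Rightarrow> ('v \<Rightarrow> nat) \<Rightarrow> 'v \<Rightarrow> certificate"

text \<open>
  A verifier receives the radius and the view of that radius, and returns whether the node
  accepts. It does not receive the number of nodes.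
\<close>

type_synonym verifier = "nat \<Rightarrow> view \<Rightarrow> bool"

text \<open>
  \<open>c\<close> bounds the identities and \<open>c'\<close> the edge weights. The radius \<open>t\<close> is a function of the
  number of nodes. The predicate \<open>pls\<close> covers all schemes of radius at most \<open>t\<close>: a verifier
  that runs for fewer rounds ignores part of the view of radius \<open>t\<close>.
\<close>

definition pls ::
  "real \<Rightarrow> real \<Rightarrow> ('v lgraph \<Rightarrow> bool) \<Rightarrow> (nat \<Rightarrow> nat) \<Rightarrow> 'v prover \<Rightarrow> verifier \<Rightarrow> bool" where
  "pls c c' P t prv ver \<longleftrightarrow>
     (\<forall>G ident. valid_lgraph c' G \<and> id_assignment c G ident \<longrightarrow>
        (let r = t (card (verts G)) in
          (P G \<longrightarrow>
             (\<forall>v\<in>verts G. ver r (view_of G ident (prv G ident) r v))) \<and>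
          (\<not> P G \<longrightarrow>
             (\<forall>cert. \<exists>v\<in>verts G. \<not> ver r (view_of G ident cert r v)))))"

definition pls_size ::
  "real \<Rightarrow> real \<Rightarrow> ('v lgraph \<Rightarrow> bool) \<Rightarrow> 'v prover \<Rightarrow> nat \<Rightarrow> enat" where
  "pls_size c c' P prv n =
     Sup {enat (length (prv G ident v)) | G ident v.
            valid_lgraph c' G \<and> id_assignment c G ident \<and> P G \<and>
            card (verts G) = n \<and> v \<in> verts G}"

text \<open>
  The infimum is a minimum as soon as a scheme exists, since \<^typ>\<open>enat\<close> is well-ordered; it is
  \<^term>\<open>\<infinity>\<close> otherwise.
\<close>

definition size_pls ::
  "real \<Rightarrow> real \<Rightarrow> ('v lgraph \<Rightarrow> bool) \<Rightarrow> (nat \<Rightarrow> nat) \<Rightarrow> nat \<Rightarrow> enat" where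
  "size_pls c c' P t n = Inf {pls_size c c' P prv n | prv ver. pls c c' P t prv ver}"

end

theory Submission
  imports Defs
begin

text \<open>
  Root the tree and give every node three things: whether it is the root, its depth modulo 3,
  which orients the tree edges towards the root, and one piece of each of two numbers. Let
  \<open>s = \<lceil>t / 2\<rceil>\<close> and cut every path to the root into segments of \<open>s\<close> nodes, the first node of
  each segment being marked; along a segment the pieces spell the number of the segment and the
  identity of the root, so that \<open>O(log n / s)\<close> bits per node suffice. Any \<open>s\<close> consecutive nodes
  of a path to the root contain all the pieces of the identity; nodes of smaller depth see the
  root itself. At the end of a segment a node sees the whole preceding segment too, because
  \<open>2 * s - 1 \<le> t\<close>, and checks that the segment numbers increase. Hence no walk along parents can
  go on forever, so the labelled edges form a forest with one root per component, and neighbours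
  in the graph comparing the claimed identity of the root force all the roots to coincide.
\<close>

section \<open>The verifier\<close>

text \<open>Layout of a certificate: root flag, segment mark, two bits of colour, then a payload.
  The payload is cut at its midpoint, so decoding requires no knowledge of the number of
  nodes.\<close>

definition flag :: "certificate \<Rightarrow> bool" where "flag c = c ! 0"

definition mark :: "certificate \<Rightarrow> bool" where "mark c = c ! 1"

text \<open>Two bits can also spell 3, which is why colours are always compared modulo 3.\<close>

definition colour :: "certificate \<Rightarrow> nat" where
  "colour c = of_bool (c ! 2) + 2 * of_bool (c ! 3)"

definition counter_piece :: "certificate \<Rightarrow> bool list" where
  "counter_piece c = (let d = drop 4 c in take (length d div 2) d)"

definition id_piece :: "certificate \<Rightarrow> bool list" where
  "id_piece c = (let d = drop 4 c in drop (length d div 2) d)"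

definition pieces_value :: "bool list list \<Rightarrow> nat" where
  "pieces_value ps = horner_sum of_bool 2 (concat ps)"

definition parents :: "('a \<Rightarrow> certificate) \<Rightarrow> 'a rel \<Rightarrow> 'a \<Rightarrow> 'a set" where
  "parents cf T x = {y. (x, y) \<in> T \<and> (colour (cf y) + 1) mod 3 = colour (cf x) mod 3}"

text \<open>The default \<open>x\<close> makes a node without a unique parent a fixed point, so a
  walk upwards that reaches the root stays there.\<close>

definition parent :: "('a \<Rightarrow> certificate) \<Rightarrow> 'a rel \<Rightarrow> 'a \<Rightarrow> 'a" where
  "parent cf T x = (if is_singleton (parents cf T x) then the_elem (parents cf T x) else x)"

abbreviation anc :: "('a \<Rightarrow> certificate) \<Rightarrow> 'a rel \<Rightarrow> nat \<Rightarrow> 'a \<Rightarrow> 'a" where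
  "anc cf T i x \<equiv> (parent cf T ^^ i) x"

text \<open>The list is reversed because pieces are laid out away from the root, lowest bits
  first.\<close>

definition window :: "('a \<Rightarrow> certificate) \<Rightarrow> 'a rel \<Rightarrow> nat \<Rightarrow> 'a \<Rightarrow> certificate list" where
  "window cf T s x = rev (map (\<lambda>i. cf (anc cf T i x)) [0..<s])"

definition counter :: "('a \<Rightarrow> certificate) \<Rightarrow> 'a rel \<Rightarrow> nat \<Rightarrow> 'a \<Rightarrow> nat" where
  "counter cf T s x = pieces_value (map counter_piece (window cf T s x))"

text \<open>A window may straddle two segments; rotating it so that the mark comes first restores
  the order of the pieces.\<close>

definition realign :: "certificate list \<Rightarrow> certificate list" where
  "realign w = dropWhile (\<lambda>c. \<not> mark c) w @ takeWhile (\<lambda>c. \<not> mark c) w"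

text \<open>Close to the root the path may have fewer than \<open>s\<close> nodes, so pieces would
  be missing; there the identity is read off the root directly.\<close>

definition root_claim ::
  "('a \<Rightarrow> nat) \<Rightarrow> ('a \<Rightarrow> certificate) \<Rightarrow> 'a rel \<Rightarrow> nat \<Rightarrow> 'a \<Rightarrow> nat" where
  "root_claim idf cf T s x =
     (let y = anc cf T (s - 1) x
      in if flag (cf y) then idf y else pieces_value (map id_piece (realign (window cf T s x))))"

text \<open>The node type is a parameter because the same check is evaluated on the identities in a
  view and on the vertices of the graph. The guard at \<open>2 * s - 2\<close> ensures that the path
  upwards is long enough for two full segments; a mark at distance \<open>s - 1\<close> says that
  \<open>x\<close> ends a segment.\<close>

definition local_ok ::
  "('a \<Rightarrow> nat) \<Rightarrow> 'a rel \<Rightarrow> 'a rel \<Rightarrow> ('a \<Rightarrow> certificate) \<Rightarrow> nat \<Rightarrow> 'a \<Rightarrow> bool" where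
  "local_ok idf A T cf s x \<longleftrightarrow>
     (\<forall>y. (x, y) \<in> T \<longrightarrow> colour (cf y) mod 3 \<noteq> colour (cf x) mod 3) \<and>
     (if flag (cf x) then parents cf T x = {} else is_singleton (parents cf T x)) \<and>
     (\<not> flag (cf (anc cf T (2 * s - 2) x)) \<longrightarrow>
        (\<exists>i<s. mark (cf (anc cf T i x))) \<and>
        (mark (cf (anc cf T (s - 1) x)) \<longrightarrow>
           mark (cf (anc cf T (2 * s - 1) x)) \<and>
           counter cf T s (anc cf T s x) < counter cf T s x)) \<and>
     (\<forall>y. (x, y) \<in> A \<longrightarrow> root_claim idf cf T s y = root_claim idf cf T s x)"

definition view_cert :: "view \<Rightarrow> nat \<Rightarrow> certificate" where
  "view_cert vw a = (THE c. \<exists>I\<in>nodes vw. node_id I = a \<and> node_cert I = c)"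

definition view_edges :: "view \<Rightarrow> nat rel" where
  "view_edges vw = {(a, b). \<exists>I\<in>nodes vw. node_id I = a \<and>
     (\<exists>w l. (Some b, w, l) \<in># node_ports I)}"

definition view_tree :: "view \<Rightarrow> nat rel" where
  "view_tree vw = {(a, b). \<exists>I\<in>nodes vw. node_id I = a \<and>
     (\<exists>w. (Some b, w, True) \<in># node_ports I)}"

text \<open>The largest \<open>s\<close> with \<open>2 * s - 1 \<le> r\<close>, the number of edges
  on a path through two segments.\<close>

definition half :: "nat \<Rightarrow> nat" where "half r = (r + 1) div 2"

definition verifier :: verifier where
  "verifier r vw =
     local_ok id (view_edges vw) (view_tree vw) (view_cert vw) (half r) (centre vw)"

definition tree_rel :: "'v lgraph \<Rightarrow> 'v rel" where
  "tree_rel G = {(u, w). {u, w} \<in> label G u}"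

section \<open>Distances in a tree\<close>

lemma relpow_segment:
  assumes "\<And>i. i < n \<Longrightarrow> (f i, f (Suc i)) \<in> R" "a \<le> b" "b \<le> n"
  shows "(f a, f b) \<in> R ^^ (b - a)"
  unfolding relpow_fun_conv using assms by (intro exI[of _ "\<lambda>i. f (a + i)"]) auto

text \<open>A shortest walk from \<open>u\<close> to \<open>w\<close> avoiding the edge has no
  repeated vertex, so the edge would close it to a cycle.\<close>

lemma edge_is_bridge:
  assumes acyc: "\<nexists>xs. cycle T xs" and e: "{u, w} \<in> T" and ne: "u \<noteq> w"
  shows "(u, w) \<notin> (adj (T - {{u, w}}))\<^sup>*"
proof
  let ?R = "adj (T - {{u, w}})"
  assume "(u, w) \<in> ?R\<^sup>*"
  then have ex: "\<exists>n. (u, w) \<in> ?R ^^ n" by (simp add: rtrancl_power)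
  define n where "n = (LEAST n. (u, w) \<in> ?R ^^ n)"
  have "(u, w) \<in> ?R ^^ n" unfolding n_def using ex by (rule LeastI_ex)
  then obtain f where f: "f 0 = u" "f n = w" "\<And>i. i < n \<Longrightarrow> (f i, f (Suc i)) \<in> ?R"
    by (auto simp: relpow_fun_conv)
  \<comment> \<open>Cutting out the part between two equal vertices would give a shorter
    walk.\<close>
  have "f i \<noteq> f j" if "i < j" "j \<le> n" for i j
  proof
    assume "f i = f j"
    moreover have "(f 0, f i) \<in> ?R ^^ (i - 0)" "(f j, f n) \<in> ?R ^^ (n - j)"
      using that f(3) by (simp_all only: relpow_segment[of n f] le0 order.refl less_imp_le order.trans[of i j n])
    ultimately have "(u, w) \<in> ?R ^^ (i + (n - j))"
      unfolding relpow_add f(1)[symmetric] f(2)[symmetric] by auto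
    then have "n \<le> i + (n - j)" unfolding n_def by (rule Least_le)
    then show False using that by simp
  qed
  then have inj: "inj_on f {0..<Suc n}"
    by (intro inj_onI) (metis atLeastLessThan_iff less_Suc_eq_le linorder_neqE_nat)
  \<comment> \<open>A walk of length 1 would be the deleted edge, so the cycle has at least three
    vertices.\<close>
  have n2: "2 \<le> n"
  proof (rule ccontr)
    assume "\<not> 2 \<le> n"
    then have "n = 0 \<or> n = 1" by auto
    then show False using f ne by (auto simp: adj_def)
  qed
  have "cycle T (map f [0..<Suc n])"
    unfolding cycle_def
  proof (intro conjI allI impI)
    show "distinct (map f [0..<Suc n])" using inj by (simp only: distinct_map distinct_upt set_upt)
    show "{map f [0..<Suc n] ! i, map f [0..<Suc n] ! Suc i} \<in> T"
      if "Suc i < length (map f [0..<Suc n])" for i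
      using that f(3)[of i] by (auto simp: adj_def simp del: upt_Suc)
    show "{last (map f [0..<Suc n]), hd (map f [0..<Suc n])} \<in> T"
      using e f(1,2) by (simp add: last_map hd_map insert_commute del: upt_Suc)
  qed (use n2 in simp)
  then show False using acyc by blast
qed

definition tdist :: "'v set set \<Rightarrow> 'v \<Rightarrow> 'v \<Rightarrow> nat" where
  "tdist T \<rho> v = (LEAST k. (\<rho>, v) \<in> adj T ^^ k)"

lemma adj_sym: "(u, w) \<in> adj T \<Longrightarrow> (w, u) \<in> adj T"
  by (simp add: adj_def insert_commute)

lemma tdist_relpow: "(\<rho>, v) \<in> (adj T)\<^sup>* \<Longrightarrow> (\<rho>, v) \<in> adj T ^^ tdist T \<rho> v"
  unfolding tdist_def rtrancl_power by (rule LeastI_ex)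

lemma tdist_le: "(\<rho>, v) \<in> adj T ^^ k \<Longrightarrow> tdist T \<rho> v \<le> k"
  unfolding tdist_def by (rule Least_le)

lemma tdist_root: "tdist T \<rho> \<rho> = 0"
  using tdist_le[where k = 0 and v = \<rho>] by force

lemma tdist_0: "(\<rho>, v) \<in> (adj T)\<^sup>* \<Longrightarrow> tdist T \<rho> v = 0 \<longleftrightarrow> v = \<rho>"
  using tdist_relpow[of \<rho> v T] by (auto simp: tdist_root)

lemma tdist_step:
  "(\<rho>, v) \<in> (adj T)\<^sup>* \<Longrightarrow> (v, w) \<in> adj T \<Longrightarrow> tdist T \<rho> w \<le> Suc (tdist T \<rho> v)"
  by (intro tdist_le) (auto dest: tdist_relpow)

lemma tdist_Suc:
  assumes "(\<rho>, v) \<in> (adj T)\<^sup>*" "tdist T \<rho> v = Suc k"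
  obtains y where "(y, v) \<in> adj T" "(\<rho>, y) \<in> (adj T)\<^sup>*" "tdist T \<rho> y = k"
proof -
  obtain y where y: "(\<rho>, y) \<in> adj T ^^ k" "(y, v) \<in> adj T"
    using tdist_relpow[OF assms(1)] assms(2) by auto
  have reach: "(\<rho>, y) \<in> (adj T)\<^sup>*" using y(1) by (rule relpow_imp_rtrancl)
  then have "tdist T \<rho> y = k"
    using tdist_le[OF y(1)] tdist_step[OF reach y(2)] assms(2) by simp
  then show thesis using that y reach by blast
qed

text \<open>Shortest paths to \<open>\<rho>\<close> from vertices of depth at most \<open>k\<close>
  use only such edges. The two restrictions exclude, for suitable \<open>k\<close>, precisely the
  edge that is to be bypassed: one within a level, or one to a deeper vertex.\<close>

definition shallow :: "'v set set \<Rightarrow> 'v \<Rightarrow> nat \<Rightarrow> 'v rel" where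
  "shallow T \<rho> k = {(a, b) \<in> adj T. tdist T \<rho> a \<le> k \<and> tdist T \<rho> b \<le> k \<and> tdist T \<rho> a \<noteq> tdist T \<rho> b}"

lemma shallow_path:
  "(\<rho>, v) \<in> (adj T)\<^sup>* \<Longrightarrow> tdist T \<rho> v \<le> k \<Longrightarrow> (v, \<rho>) \<in> (shallow T \<rho> k)\<^sup>*"
proof (induction "tdist T \<rho> v" arbitrary: v)
  case 0
  then show ?case by (simp add: tdist_0)
next
  case (Suc d)
  obtain y where y: "(y, v) \<in> adj T" "(\<rho>, y) \<in> (adj T)\<^sup>*" "tdist T \<rho> y = d"
    using tdist_Suc Suc.prems(1) Suc.hyps(2) by metis
  then have "(v, y) \<in> shallow T \<rho> k"
    using Suc.prems Suc.hyps(2) by (auto simp: shallow_def adj_sym)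
  moreover have "(y, \<rho>) \<in> (shallow T \<rho> k)\<^sup>*" using Suc y by auto
  ultimately show ?case by (rule converse_rtrancl_into_rtrancl)
qed

lemma shallow_connected:
  assumes "(\<rho>, u) \<in> (adj T)\<^sup>*" "(\<rho>, w) \<in> (adj T)\<^sup>*" "tdist T \<rho> u \<le> k" "tdist T \<rho> w \<le> k"
  shows "(u, w) \<in> (shallow T \<rho> k)\<^sup>*"
proof -
  have "sym ((shallow T \<rho> k)\<^sup>*)"
    by (intro sym_rtrancl) (auto simp: sym_def shallow_def adj_sym)
  then show ?thesis
    using shallow_path[OF assms(1,3)] shallow_path[OF assms(2,4)] by (metis rtrancl_trans symE)
qed

text \<open>The ends of an edge within a level are also joined by their shortest paths to
  \<open>\<rho>\<close>, which avoid it; but every edge of an acyclic graph is a bridge.\<close>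

lemma tdist_edge_neq:
  assumes acyc: "\<nexists>xs. cycle T xs" and e: "(u, w) \<in> adj T" and ne: "u \<noteq> w"
    and reach: "(\<rho>, u) \<in> (adj T)\<^sup>*"
  shows "tdist T \<rho> u \<noteq> tdist T \<rho> w"
proof
  assume eq: "tdist T \<rho> u = tdist T \<rho> w"
  have "(u, w) \<in> (shallow T \<rho> (tdist T \<rho> u))\<^sup>*"
    using shallow_connected[OF reach, of w] e reach eq by (simp add: rtrancl_into_rtrancl)
  moreover have "shallow T \<rho> (tdist T \<rho> u) \<subseteq> adj (T - {{u, w}})"
    using eq by (auto simp: shallow_def adj_def doubleton_eq_iff)
  ultimately have "(u, w) \<in> (adj (T - {{u, w}}))\<^sup>*" using rtrancl_mono by blast
  then show False using edge_is_bridge[OF acyc _ ne] e by (auto simp: adj_def)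
qed

text \<open>With two parents, \<open>v\<close> would still reach \<open>a\<close> without the edge
  \<open>{v, a}\<close>: first to \<open>b\<close>, then through the shallower vertices.\<close>

lemma tdist_parent_unique:
  assumes acyc: "\<nexists>xs. cycle T xs" and reach: "(\<rho>, v) \<in> (adj T)\<^sup>*"
    and a: "(v, a) \<in> adj T" "tdist T \<rho> v = Suc (tdist T \<rho> a)"
    and b: "(v, b) \<in> adj T" "tdist T \<rho> v = Suc (tdist T \<rho> b)"
  shows "a = b"
proof (rule ccontr)
  assume ne: "a \<noteq> b"
  have "(b, a) \<in> (shallow T \<rho> (tdist T \<rho> a))\<^sup>*"
    using a b reach by (intro shallow_connected) (auto intro: rtrancl_into_rtrancl)
  moreover have "shallow T \<rho> (tdist T \<rho> a) \<subseteq> adj (T - {{v, a}})"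
    using a by (auto simp: shallow_def adj_def doubleton_eq_iff)
  ultimately have "(b, a) \<in> (adj (T - {{v, a}}))\<^sup>*" using rtrancl_mono by blast
  moreover have "(v, b) \<in> adj (T - {{v, a}})"
    using ne a b by (auto simp: adj_def doubleton_eq_iff)
  ultimately have "(v, a) \<in> (adj (T - {{v, a}}))\<^sup>*" by (rule converse_rtrancl_into_rtrancl[rotated])
  moreover have "v \<noteq> a" using a(2) by auto
  ultimately show False using edge_is_bridge[OF acyc] a(1) by (auto simp: adj_def)
qed

section \<open>Splitting numbers into pieces\<close>

definition piece :: "nat \<Rightarrow> nat \<Rightarrow> nat \<Rightarrow> bool list" where
  "piece q N j = map (\<lambda>i. bit N (j * q + i)) [0..<q]"

lemma length_piece [simp]: "length (piece q N j) = q"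
  by (simp add: piece_def)

lemma concat_pieces: "concat (map (piece q N) [0..<s]) = map (bit N) [0..<s * q]"
proof (induction s)
  case (Suc s)
  have "map (bit N) [0..<Suc s * q] = map (bit N) [0..<s * q] @ map (bit N) [s * q..<s * q + q]"
    by (simp add: upt_add_eq_append[symmetric] flip: map_append) (simp add: add.commute)
  moreover have "map (bit N) [s * q..<s * q + q] = piece q N s"
    unfolding piece_def by (rule nth_equalityI) auto
  ultimately show ?case using Suc by simp
qed simp

lemma pieces_value_piece:
  "N < 2 ^ (s * q) \<Longrightarrow> pieces_value (map (piece q N) [0..<s]) = N"
  unfolding pieces_value_def concat_pieces horner_sum_bit_eq_take_bit
  by (simp add: take_bit_nat_eq_self)

text \<open>The honest certificate depends only on the depth \<open>d\<close>: segment
  \<open>d div s\<close>, position \<open>d mod s\<close> in it. \<open>R\<close> is the identity of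
  the root and \<open>q\<close> the length of a piece.\<close>

definition depth_cert :: "nat \<Rightarrow> nat \<Rightarrow> nat \<Rightarrow> nat \<Rightarrow> certificate" where
  "depth_cert s q R d =
     [d = 0, s dvd d, d mod 3 = 1, d mod 3 = 2] @ piece q (d div s) (d mod s) @ piece q R (d mod s)"

lemma depth_cert_simps [simp]:
  "flag (depth_cert s q R d) \<longleftrightarrow> d = 0"
  "mark (depth_cert s q R d) \<longleftrightarrow> s dvd d"
  "colour (depth_cert s q R d) = d mod 3"
  "counter_piece (depth_cert s q R d) = piece q (d div s) (d mod s)"
  "id_piece (depth_cert s q R d) = piece q R (d mod s)"
  "length (depth_cert s q R d) = 4 + 2 * q"
proof -
  have "d mod 3 = 0 \<or> d mod 3 = 1 \<or> d mod 3 = 2"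
    using mod_less_divisor[of 3 d] by linarith
  then show "colour (depth_cert s q R d) = d mod 3"
    by (auto simp: colour_def depth_cert_def)
qed (simp_all add: flag_def mark_def counter_piece_def id_piece_def depth_cert_def)

lemma counter_pieces:
  "s \<ge> 1 \<Longrightarrow> map (\<lambda>d. piece q (d div s) (d mod s)) [k * s..<k * s + s] = map (piece q k) [0..<s]"
  by (rule nth_equalityI) auto

text \<open>Among \<open>s\<close> consecutive depths exactly one is divisible by \<open>s\<close>;
  rotating the list to start there makes the residues run through 0, ...,
  \<open>s - 1\<close>.\<close>

lemma realign_depth_cert:
  assumes s: "s \<ge> 1"
  shows "map id_piece (realign (map (depth_cert s q R) [a..<a + s])) = map (piece q R) [0..<s]"
proof -
  \<comment> \<open>This is \<open>a / s\<close> rounded up, so \<open>s * M\<close> is the only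
    marked depth in the window.\<close>
  define M where "M = (a + s - 1) div s"
  have M: "a \<le> s * M" "s * M < a + s"
  proof -
    have "s * M + (a + s - 1) mod s = a + s - 1" unfolding M_def by simp
    moreover have "(a + s - 1) mod s < s" using s by simp
    ultimately show "a \<le> s * M" "s * M < a + s" using s by linarith+
  qed
  let ?f = "depth_cert s q R" and ?P = "\<lambda>c. \<not> mark c"
  have not: "\<not> s dvd d" if "d \<in> set [a..<s * M]" for d
  proof
    assume "s dvd d"
    then obtain e where e: "d = s * e" by blast
    then have "e < M" using that by simp
    then have "s * Suc e \<le> s * M" by (simp only: mult_le_mono Suc_leI le_refl)
    then show False using that e M by simp
  qed
  have upt: "[a..<a + s] = [a..<s * M] @ [s * M..<a + s]"
    using M upt_add_eq_append[of a "s * M" "a + s - s * M"] by simp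
  have "takeWhile ?P (map ?f [a..<a + s]) = map ?f [a..<s * M]"
    and "dropWhile ?P (map ?f [a..<a + s]) = map ?f [s * M..<a + s]"
    unfolding upt map_append using not M
    by (subst takeWhile_append2 dropWhile_append2; force simp: upt_conv_Cons)+
  then have "realign (map ?f [a..<a + s]) = map ?f ([s * M..<a + s] @ [a..<s * M])"
    by (simp add: realign_def)
  moreover have "map (\<lambda>d. d mod s) ([s * M..<a + s] @ [a..<s * M]) = [0..<s]"
  proof (rule nth_equalityI)
    fix i assume "i < length (map (\<lambda>d. d mod s) ([s * M..<a + s] @ [a..<s * M]))"
    then have i: "i < s" using M by simp
    show "map (\<lambda>d. d mod s) ([s * M..<a + s] @ [a..<s * M]) ! i = [0..<s] ! i"
    proof (cases "i < a + s - s * M")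
      case True
      then show ?thesis using i by (simp add: nth_append)
    next
      case False
      \<comment> \<open>Index \<open>i\<close> now lies in the part moved to the end, which belongs
        to segment \<open>M - 1\<close>; its depth is \<open>i + s * (M - 1)\<close>, again with
        residue \<open>i\<close>.\<close>
      then have "M > 0" using M i by (cases M) auto
      then obtain M' where M': "M = Suc M'" using gr0_conv_Suc by blast
      have "a + (i - (a + s - s * M)) = i + s * M'" "i - (a + s - s * M) < s * M - a"
        using False M M' i by simp_all
      then show ?thesis using False i M by (simp add: nth_append del: add_diff_cancel diff_diff_left)
    qed
  qed (use M in simp)
  then have "map (\<lambda>d. piece q R (d mod s)) ([s * M..<a + s] @ [a..<s * M]) = map (piece q R) [0..<s]"
    by (metis map_map[of "piece q R" "\<lambda>d. d mod s", unfolded comp_def])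
  ultimately show ?thesis by (simp add: comp_def)
qed

section \<open>Evaluating the verifier on the graph\<close>

lemma parents_singleton:
  "is_singleton (parents cf T x) \<Longrightarrow> parents cf T x = {parent cf T x}"
  by (simp add: parent_def flip: is_singleton_the_elem)

lemma parent_mem_parents:
  "parent cf T x \<noteq> x \<Longrightarrow> parent cf T x \<in> parents cf T x"
  by (auto simp: parent_def is_singleton_def split: if_splits)

context
  fixes G :: "'v lgraph" and c c' :: real and ident :: "'v \<Rightarrow> nat"
  assumes valid: "valid_lgraph c' G" and ids: "id_assignment c G ident"
begin

abbreviation (input) "tree_edges \<equiv> \<Union>v\<in>verts G. label G v"

lemma finite_verts: "finite (verts G)"
  using valid by (auto simp: valid_lgraph_def simple_graph_def)

lemma edge_verts: "{u, w} \<in> edges G \<Longrightarrow> u \<in> verts G \<and> w \<in> verts G \<and> u \<noteq> w"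
  using valid unfolding valid_lgraph_def simple_graph_def
  by (metis doubleton_eq_iff insert_absorb2)

lemma tree_rel_edge: "(u, w) \<in> tree_rel G \<Longrightarrow> u \<in> verts G \<Longrightarrow> (u, w) \<in> adj (edges G)"
  using valid by (auto simp: valid_lgraph_def tree_rel_def adj_def)

lemma tree_rel_sym: "(u, w) \<in> tree_rel G \<Longrightarrow> u \<in> verts G \<Longrightarrow> (w, u) \<in> tree_rel G"
  using valid tree_rel_edge[of u w]
  by (auto simp: valid_lgraph_def tree_rel_def adj_def insert_commute)

text \<open>A label contains only edges incident to its vertex, so an edge of the union comes from
  the label of one of its ends, and consistency carries it to the other.\<close>

lemma tree_edges_iff:
  assumes "u \<in> verts G"
  shows "{u, w} \<in> tree_edges \<longleftrightarrow> (u, w) \<in> tree_rel G"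
proof
  assume "{u, w} \<in> tree_edges"
  then obtain z where z: "z \<in> verts G" "{u, w} \<in> label G z" by blast
  then have "{u, w} \<in> edges G" "z \<in> {u, w}"
    using valid by (auto simp: valid_lgraph_def)
  then show "(u, w) \<in> tree_rel G"
    using z valid by (auto simp: valid_lgraph_def tree_rel_def)
qed (use assms in \<open>auto simp: tree_rel_def\<close>)

lemma hop_ball_step:
  "u \<in> hop_ball (edges G) k v \<Longrightarrow> {u, w} \<in> edges G \<Longrightarrow> w \<in> hop_ball (edges G) (Suc k) v"
  unfolding hop_ball_def adj_def by (force intro!: relpow_Suc_I)

lemma hop_ball_mono: "u \<in> hop_ball E k v \<Longrightarrow> k \<le> l \<Longrightarrow> u \<in> hop_ball E l v"
  unfolding hop_ball_def using order_trans by blast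

lemma hop_ball_verts:
  assumes "v \<in> verts G" shows "hop_ball (edges G) r v \<subseteq> verts G"
proof -
  have "u \<in> verts G" if "(v, u) \<in> adj (edges G) ^^ k" for u k
    using that
  proof (induction k arbitrary: u)
    case (Suc k)
    then obtain y where "(y, u) \<in> adj (edges G)" by auto
    then show ?case using edge_verts by (auto simp: adj_def)
  qed (use assms in auto)
  then show ?thesis by (auto simp: hop_ball_def)
qed

context
  fixes v :: 'v and r :: nat and cert :: "'v \<Rightarrow> certificate"
  assumes v: "v \<in> verts G" and r: "r \<ge> 1"
begin

abbreviation (input) "vw \<equiv> view_of G ident cert r v"
abbreviation (input) "h k \<equiv> hop_ball (edges G) k v"

lemma ident_eq_ball: "u \<in> h k \<Longrightarrow> w \<in> h l \<Longrightarrow> ident u = ident w \<longleftrightarrow> u = w"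
  using hop_ball_verts[OF v] ids unfolding id_assignment_def
  by (meson inj_on_eq_iff subset_iff)

lemma view_cert_eq:
  assumes "u \<in> h r" shows "view_cert vw (ident u) = cert u"
  unfolding view_cert_def
proof (rule the_equality)
  show "\<exists>I\<in>nodes vw. node_id I = ident u \<and> node_cert I = cert u"
    using assms by (auto simp: view_of_def Let_def info_of_def)
qed (use assms ident_eq_ball in \<open>auto simp: view_of_def Let_def info_of_def\<close>)

text \<open>Since \<open>mset_set\<close> of an infinite set is empty, finiteness ensures that the
  ports really list all incident edges.\<close>

lemma finite_nbrs: "finite {w. {u, w} \<in> edges G}"
  by (rule finite_subset[OF _ finite_verts]) (use edge_verts in auto)

lemma port_iff:
  "(Some b, k, l) \<in># node_ports (info_of G ident cert B u) \<longleftrightarrow>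
     (\<exists>w\<in>B. {u, w} \<in> edges G \<and> b = ident w \<and> k = weight G {u, w} \<and> l = ({u, w} \<in> label G u))"
  using finite_nbrs[of u] by (auto simp: info_of_def port_of_def image_iff)

lemma nodes_view: "nodes vw = info_of G ident cert (h r) ` h r"
  by (simp add: view_of_def Let_def)

lemma node_id_info: "node_id (info_of G ident cert B u) = ident u"
  by (simp add: info_of_def)

lemma view_edges_eq:
  "view_edges vw =
     {(ident u, ident w) | u w. u \<in> h r \<and> w \<in> h r \<and> (u, w) \<in> adj (edges G)}"
  unfolding view_edges_def nodes_view adj_def bex_simps image_iff
  by (auto simp: port_iff node_id_info)

lemma view_tree_eq:
  "view_tree vw =
     {(ident u, ident w) | u w. u \<in> h r \<and> w \<in> h r \<and> (u, w) \<in> tree_rel G}"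
proof -
  have "(u, w) \<in> tree_rel G \<longleftrightarrow> {u, w} \<in> edges G \<and> {u, w} \<in> label G u" if "u \<in> h r" for u w
    using that tree_rel_edge hop_ball_verts[OF v] by (auto simp: tree_rel_def adj_def)
  then show ?thesis
    unfolding view_tree_def nodes_view by (auto simp: port_iff node_id_info) blast
qed

text \<open>All neighbours of a node at distance less than \<open>r\<close> lie in the ball, so the
  view hides none of them; this can fail at distance exactly \<open>r\<close>.\<close>

lemma view_edges_nbrs:
  assumes "u \<in> h k" "k < r"
  shows "(ident u, b) \<in> view_edges vw \<longleftrightarrow> (\<exists>w\<in>h (Suc k). (u, w) \<in> adj (edges G) \<and> b = ident w)"
proof -
  have "u \<in> h r" and "h (Suc k) \<subseteq> h r"
    using assms by (auto elim: hop_ball_mono)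
  then show ?thesis
    using assms hop_ball_step[of u k v] ident_eq_ball[of u r]
    unfolding view_edges_eq adj_def by (auto; blast)
qed

lemma tree_rel_ball:
  assumes "u \<in> h k" "(u, w) \<in> tree_rel G"
  shows "w \<in> h (Suc k)"
proof -
  have "u \<in> verts G" using assms(1) hop_ball_verts[OF v] by auto
  then show ?thesis using assms tree_rel_edge hop_ball_step by (auto simp: adj_def)
qed

lemma view_tree_nbrs:
  assumes "u \<in> h k" "k < r"
  shows "(ident u, b) \<in> view_tree vw \<longleftrightarrow> (\<exists>w\<in>h (Suc k). (u, w) \<in> tree_rel G \<and> b = ident w)"
proof -
  have u: "u \<in> h r" and "h (Suc k) \<subseteq> h r"
    using assms by (auto elim: hop_ball_mono)
  then show ?thesis
    using tree_rel_ball[OF assms(1)] ident_eq_ball[of u r]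
    unfolding view_tree_eq by (auto; blast)
qed

lemma parents_ball:
  assumes "u \<in> h k" "k < r" "w \<in> parents cert (tree_rel G) u"
  shows "w \<in> h (Suc k)"
  using assms tree_rel_ball by (simp add: parents_def)

lemma view_parents:
  assumes "u \<in> h k" "k < r"
  shows "parents (view_cert vw) (view_tree vw) (ident u) = ident ` parents cert (tree_rel G) u"
proof -
  have sub: "u \<in> h r" "h (Suc k) \<subseteq> h r"
    using assms by (auto elim: hop_ball_mono)
  have "b \<in> parents (view_cert vw) (view_tree vw) (ident u) \<longleftrightarrow>
        (\<exists>w\<in>h (Suc k). w \<in> parents cert (tree_rel G) u \<and> b = ident w)" for b
    unfolding parents_def mem_Collect_eq view_tree_nbrs[OF assms]
    using sub by (auto simp: view_cert_eq subset_iff)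
  then show ?thesis
    using parents_ball[OF assms] by blast
qed

lemma is_singleton_ident_parents:
  assumes "u \<in> h k" "k < r"
  shows "is_singleton (ident ` parents cert (tree_rel G) u)
         \<longleftrightarrow> is_singleton (parents cert (tree_rel G) u)"
proof -
  have "inj_on ident (parents cert (tree_rel G) u)"
    using parents_ball[OF assms] ident_eq_ball by (meson inj_onI)
  then show ?thesis by (simp add: is_singleton_altdef card_image)
qed

lemma view_parent:
  assumes "u \<in> h k" "k < r"
  shows "parent (view_cert vw) (view_tree vw) (ident u) = ident (parent cert (tree_rel G) u)"
  unfolding parent_def view_parents[OF assms] is_singleton_ident_parents[OF assms]
  by (auto simp: is_singleton_def)

lemma parent_ball:
  assumes "u \<in> h k" "k < r"
  shows "parent cert (tree_rel G) u \<in> h (Suc k)"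
  using parents_ball[OF assms parent_mem_parents] hop_ball_mono[OF assms(1), of "Suc k"]
  by (cases "parent cert (tree_rel G) u = u") auto

text \<open>Every step upwards costs one unit of the radius, whence the budget
  \<open>k + i \<le> r\<close>.\<close>

lemma view_anc:
  assumes "u \<in> h k" "k + i \<le> r"
  shows "anc (view_cert vw) (view_tree vw) i (ident u) = ident (anc cert (tree_rel G) i u)
         \<and> anc cert (tree_rel G) i u \<in> h (k + i)"
  using assms(2)
proof (induction i)
  case (Suc i)
  then show ?case using view_parent[of _ "k + i"] parent_ball[of _ "k + i"] by auto
qed (use assms in auto)

lemma view_anc_cert:
  assumes "u \<in> h k" "k + i \<le> r"
  shows "view_cert vw (anc (view_cert vw) (view_tree vw) i (ident u))
         = cert (anc cert (tree_rel G) i u)"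
  using view_anc[OF assms] view_cert_eq hop_ball_mono assms(2) by metis

text \<open>A window of \<open>s\<close> certificates climbs only \<open>s - 1\<close> steps, so the
  budget is \<open>Suc r\<close>.\<close>

lemma view_window:
  assumes "u \<in> h k" "k + s \<le> Suc r"
  shows "window (view_cert vw) (view_tree vw) s (ident u) = window cert (tree_rel G) s u"
  unfolding window_def using assms by (auto intro!: view_anc_cert)

lemma view_root_claim:
  assumes "u \<in> h k" "k + s \<le> Suc r" "1 \<le> s"
  shows "root_claim id (view_cert vw) (view_tree vw) s (ident u)
         = root_claim ident cert (tree_rel G) s u"
  using assms view_anc[of u k "s - 1"] view_anc_cert[of u k "s - 1"]
  by (simp add: root_claim_def Let_def view_window)

text \<open>This removes views from the argument: soundness and completeness can both be proved for
  \<open>local_ok\<close> on the graph itself.\<close>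

lemma verifier_view:
  "verifier r vw = local_ok ident (adj (edges G)) (tree_rel G) cert (half r) v"
proof -
  define s where "s = half r"
  have s: "1 \<le> s" "2 * s \<le> Suc r" "1 + s \<le> Suc r"
    using r by (auto simp: s_def half_def)
  have v0: "v \<in> h 0" by (auto simp: hop_ball_def)
  have cv: "view_cert vw (ident v) = cert v"
    using view_anc_cert[OF v0, of 0] by simp
  have S: "h (Suc 0) \<subseteq> h r" using r by (auto elim: hop_ball_mono)
  \<comment> \<open>Turns quantification over identities of neighbours into quantification over the
    neighbours.\<close>
  have img: "(\<forall>b. (\<exists>w\<in>S. Q w \<and> b = ident w) \<longrightarrow> P b) \<longleftrightarrow> (\<forall>w. Q w \<longrightarrow> P' w)"
    if "\<And>w. Q w \<Longrightarrow> w \<in> S" "\<And>w. w \<in> S \<Longrightarrow> P (ident w) = P' w" for S Q P P'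
    using that by (auto 4 3)
  have 1: "(\<forall>b. (ident v, b) \<in> view_tree vw \<longrightarrow>
              colour (view_cert vw b) mod 3 \<noteq> colour (view_cert vw (ident v)) mod 3)
        \<longleftrightarrow> (\<forall>y. (v, y) \<in> tree_rel G \<longrightarrow> colour (cert y) mod 3 \<noteq> colour (cert v) mod 3)"
    unfolding view_tree_nbrs[OF v0 r[unfolded One_nat_def Suc_le_eq]] cv
    using tree_rel_ball[OF v0] S by (intro img) (auto simp: view_cert_eq subset_iff)
  have 2: "parents (view_cert vw) (view_tree vw) (ident v) = ident ` parents cert (tree_rel G) v"
    using view_parents[OF v0] r by simp
  have 3: "is_singleton (ident ` parents cert (tree_rel G) v)
           \<longleftrightarrow> is_singleton (parents cert (tree_rel G) v)"
    using is_singleton_ident_parents[OF v0] r by simp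
  have 4: "(\<forall>b. (ident v, b) \<in> view_edges vw \<longrightarrow>
      root_claim id (view_cert vw) (view_tree vw) s b =
      root_claim id (view_cert vw) (view_tree vw) s (ident v))
    \<longleftrightarrow> (\<forall>y. (v, y) \<in> adj (edges G) \<longrightarrow>
      root_claim ident cert (tree_rel G) s y = root_claim ident cert (tree_rel G) s v)"
    unfolding view_edges_nbrs[OF v0 r[unfolded One_nat_def Suc_le_eq]]
  proof (rule img)
    show "w \<in> h (Suc 0)" if "(v, w) \<in> adj (edges G)" for w
      using that hop_ball_step[OF v0] by (auto simp: adj_def)
    show "root_claim id (view_cert vw) (view_tree vw) s (ident w) =
        root_claim id (view_cert vw) (view_tree vw) s (ident v) \<longleftrightarrow>
        root_claim ident cert (tree_rel G) s w = root_claim ident cert (tree_rel G) s v"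
      if "w \<in> h (Suc 0)" for w
      using view_root_claim[OF that] view_root_claim[OF v0] s by simp
  qed
  have 5: "view_cert vw (anc (view_cert vw) (view_tree vw) i (ident v))
           = cert (anc cert (tree_rel G) i v)" if "i < 2 * s" for i
    using view_anc_cert[OF v0, of i] that s by simp
  have 6: "counter (view_cert vw) (view_tree vw) s (ident v) = counter cert (tree_rel G) s v"
    using view_window[OF v0] s by (simp add: counter_def)
  have 7: "counter (view_cert vw) (view_tree vw) s
             (anc (view_cert vw) (view_tree vw) s (ident v))
           = counter cert (tree_rel G) s (anc cert (tree_rel G) s v)"
  proof -
    \<comment> \<open>The window that starts \<open>s\<close> steps up is the farthest information
      read; it is visible because \<open>s + s \<le> Suc r\<close>.\<close>
    have "s \<le> r" using s by simp
    then show ?thesis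
      using view_anc[OF v0, of s] view_window[of "anc cert (tree_rel G) s v" s s] s
      by (simp add: counter_def)
  qed
  have c: "centre vw = ident v" by (simp add: view_of_def Let_def)
  have m: "(\<exists>i<s. mark (view_cert vw (anc (view_cert vw) (view_tree vw) i (ident v))))
     \<longleftrightarrow> (\<exists>i<s. mark (cert (anc cert (tree_rel G) i v)))"
    by (rule ex_cong1) (use 5 in \<open>auto simp: mult_2\<close>)
  have lt: "2 * s - 2 < 2 * s" "s - 1 < 2 * s" "2 * s - 1 < 2 * s" using s by auto
  note conj = arg_cong2[where f = "(\<and>)"]
  show ?thesis
    unfolding verifier_def c s_def[symmetric] local_ok_def
  proof (intro conj 1 4)
    show "(if flag (view_cert vw (ident v)) then parents (view_cert vw) (view_tree vw) (ident v) = {}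
       else is_singleton (parents (view_cert vw) (view_tree vw) (ident v)))
      = (if flag (cert v) then parents cert (tree_rel G) v = {}
         else is_singleton (parents cert (tree_rel G) v))"
      by (simp only: cv 2 3 image_is_empty)
  qed (simp only: 5[OF lt(1)] 5[OF lt(2)] 5[OF lt(3)] m 6 7)
qed

end

section \<open>Soundness\<close>

context
  fixes cert :: "'v \<Rightarrow> certificate" and s :: nat
  assumes s: "s \<ge> 1"
    and ok: "\<And>v. v \<in> verts G \<Longrightarrow> local_ok ident (adj (edges G)) (tree_rel G) cert s v"
begin

abbreviation (input) "par \<equiv> parent cert (tree_rel G)"
abbreviation (input) "up \<equiv> anc cert (tree_rel G)"

lemma parent_verts: "x \<in> verts G \<Longrightarrow> par x \<in> verts G"
  using parent_mem_parents[of cert "tree_rel G" x] tree_rel_edge[of x "par x"] edge_verts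
  by (fastforce simp: parents_def adj_def)

lemma up_verts: "x \<in> verts G \<Longrightarrow> up i x \<in> verts G"
  by (induction i) (auto intro: parent_verts)

lemma parents_eq: "x \<in> verts G \<Longrightarrow> \<not> flag (cert x) \<Longrightarrow> parents cert (tree_rel G) x = {par x}"
  using ok[of x] by (auto simp: local_ok_def parent_def is_singleton_def)

lemma parents_flag: "x \<in> verts G \<Longrightarrow> flag (cert x) \<Longrightarrow> parents cert (tree_rel G) x = {}"
  using ok[of x] by (simp add: local_ok_def)

lemma parent_flag: "x \<in> verts G \<Longrightarrow> flag (cert x) \<Longrightarrow> par x = x"
  using parents_flag[of x] by (auto simp: parent_def is_singleton_def)

lemma up_flag: "x \<in> verts G \<Longrightarrow> flag (cert x) \<Longrightarrow> up i x = x"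
  by (induction i) (auto simp: parent_flag)

lemma up_add: "up (i + j) x = up i (up j x)"
  by (simp add: funpow_add)

text \<open>On a walk that never reaches a root the segment counters would decrease forever.\<close>

lemma up_reaches_flag:
  assumes v: "v \<in> verts G"
  shows "\<exists>i. flag (cert (up i v))"
proof (rule ccontr)
  assume "\<not> ?thesis"
  then have nf: "\<not> flag (cert (up i v))" for i by blast
  define K where "K = (\<lambda>x. counter cert (tree_rel G) s x)"
  have marks: "\<exists>i<s. mark (cert (up i (up j v)))"
    and desc: "mark (cert (up (s - 1) (up j v))) \<Longrightarrow>
      mark (cert (up (2 * s - 1) (up j v))) \<and> K (up s (up j v)) < K (up j v)" for j
    using ok[OF up_verts[OF v, of j]] nf[of "2 * s - 2 + j"]
    by (auto simp: local_ok_def K_def up_add)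
  obtain i where i: "mark (cert (up i (up (s - 1) v)))" using marks by blast
  \<comment> \<open>From the first segment end \<open>up i v\<close> on, every \<open>s\<close>
    steps lead to another segment end with a smaller counter, so \<open>j\<close> cannot exceed the
    initial counter.\<close>
  have "mark (cert (up (s - 1) (up (j * s + i) v))) \<and> K (up (j * s + i) v) + j \<le> K (up i v)" for j
  proof (induction j)
    case 0
    then show ?case using i by (simp add: up_add[symmetric] add.commute)
  next
    case (Suc j)
    have "2 * s - 1 = s - 1 + s" using s by simp
    then have "up (2 * s - 1) (up (j * s + i) v) = up (s - 1) (up (Suc j * s + i) v)"
      and "up s (up (j * s + i) v) = up (Suc j * s + i) v"
      by (simp_all add: up_add[symmetric] add.assoc)
    then show ?case using desc[of "j * s + i"] Suc by simp
  qed
  from this[of "Suc (K (up i v))"] show False by simp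
qed

text \<open>A rank that drops by one along each parent step; it replaces the depth, which is not yet
  available for arbitrary certificates.\<close>

definition flag_dist :: "'v \<Rightarrow> nat" where
  "flag_dist v = (LEAST i. flag (cert (up i v)))"

lemma flag_dist_parent:
  assumes v: "v \<in> verts G" and nf: "\<not> flag (cert v)"
  shows "flag_dist v = Suc (flag_dist (par v))"
proof -
  obtain i where "flag (cert (up i v))" using up_reaches_flag[OF v] by blast
  moreover have "up (Suc i) v = up i (par v)" for i by (simp add: funpow_swap1)
  ultimately show ?thesis
    unfolding flag_dist_def
    using Least_Suc[of "\<lambda>i. flag (cert (up i v))" i] nf by simp
qed

text \<open>Two different residues modulo 3 differ by one in one direction or the other, so each
  labelled edge is a parent edge of one of its ends.\<close>

lemma tree_rel_parent:
  assumes uw: "(u, w) \<in> tree_rel G" and u: "u \<in> verts G"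
  shows "w = par u \<and> flag_dist w < flag_dist u \<or> u = par w \<and> flag_dist u < flag_dist w"
proof -
  have wu: "(w, u) \<in> tree_rel G" using tree_rel_sym[OF uw u] .
  have w: "w \<in> verts G" using tree_rel_edge[OF uw u] edge_verts by (auto simp: adj_def)
  have "colour (cert w) mod 3 \<noteq> colour (cert u) mod 3"
    using ok[OF u] uw by (auto simp: local_ok_def)
  then have "(colour (cert w) + 1) mod 3 = colour (cert u) mod 3 \<or>
        (colour (cert u) + 1) mod 3 = colour (cert w) mod 3"
    using mod_less_divisor[of 3 "colour (cert u)"] mod_less_divisor[of 3 "colour (cert w)"]
    by (auto simp: mod_Suc)
  then have "w \<in> parents cert (tree_rel G) u \<or> u \<in> parents cert (tree_rel G) w"
    using uw wu by (auto simp: parents_def)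
  moreover have "y = par x \<and> flag_dist y < flag_dist x"
    if "x \<in> verts G" "y \<in> parents cert (tree_rel G) x" for x y
  proof -
    have nf: "\<not> flag (cert x)" using parents_flag[OF that(1)] that(2) by auto
    then show ?thesis
      using parents_eq[OF that(1) nf] flag_dist_parent[OF that(1) nf] that(2) by simp
  qed
  ultimately show ?thesis using u w by blast
qed

text \<open>Both cycle neighbours of a vertex of maximal rank would be its unique parent, but they
  are distinct vertices.\<close>

lemma no_cycle: "\<not> cycle tree_edges xs"
proof
  assume cyc: "cycle tree_edges xs"
  define n where "n = length xs"
  define x where "x = (\<lambda>i. xs ! (i mod n))"
  have n: "n \<ge> 3" and dist: "distinct xs" using cyc by (auto simp: cycle_def n_def)
  have xs: "xs \<noteq> []" using n by (auto simp: n_def)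
  have edge: "{x i, x (Suc i)} \<in> tree_edges" for i
  proof (cases "Suc (i mod n) = n")
    case True
    then have "i mod n = n - 1" by simp
    with True have "x i = last xs" "x (Suc i) = hd xs"
      using xs by (auto simp: x_def last_conv_nth hd_conv_nth n_def mod_Suc)
    then show ?thesis using cyc by (simp add: cycle_def)
  next
    case False
    have "i mod n < n" using n by simp
    with False have "Suc (i mod n) < n" "Suc i mod n = Suc (i mod n)" by (simp_all add: mod_Suc)
    then show ?thesis using cyc by (simp add: cycle_def x_def n_def)
  qed
  have verts: "x i \<in> verts G" for i
  proof -
    have "{x i, x (Suc i)} \<in> edges G" using edge[of i] valid by (auto simp: valid_lgraph_def)
    then show ?thesis using edge_verts by blast
  qed
  have rel: "(x i, x (Suc i)) \<in> tree_rel G" for i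
    using edge[of i] tree_edges_iff[OF verts] by blast
  obtain i where i: "i < n" "\<And>j. j < n \<Longrightarrow> flag_dist (x j) \<le> flag_dist (x i)"
  proof -
    have "Max ((\<lambda>i. flag_dist (x i)) ` {..<n}) \<in> (\<lambda>i. flag_dist (x i)) ` {..<n}"
      using n by (intro Max_in) (auto simp: lessThan_empty_iff)
    then obtain i where "i < n" "flag_dist (x i) = Max ((\<lambda>i. flag_dist (x i)) ` {..<n})" by auto
    with that[of i] show ?thesis by simp
  qed
  have le: "flag_dist (x j) \<le> flag_dist (x i)" for j
    using i(2)[of "j mod n"] n by (simp add: x_def)
  have "x (Suc i) = par (x i)"
    using tree_rel_parent[OF rel verts, of i] le[of "Suc i"] by auto
  moreover have "x (i + n - 1) = par (x i)"
  proof -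
    have "x (Suc (i + n - 1)) = x i" using n by (simp add: x_def)
    then show ?thesis
      using tree_rel_parent[OF rel verts, of "i + n - 1"] le[of "i + n - 1"] by auto
  qed
  ultimately have "xs ! (Suc i mod n) = xs ! ((i + n - 1) mod n)" by (simp add: x_def)
  then have "Suc i mod n = (i + n - 1) mod n"
    using nth_eq_iff_index_eq[OF dist] n mod_less_divisor[of n] unfolding n_def by (metis gr0I not_numeral_le_zero)
  \<comment> \<open>Successor and predecessor of \<open>i\<close> coincide modulo \<open>n\<close>;
    adding one yields \<open>i + 2\<close> congruent to \<open>i\<close>, impossible for
    \<open>n \<ge> 3\<close>.\<close>
  then have "(Suc i + 1) mod n = (i + n - 1 + 1) mod n" by (metis mod_add_left_eq)
  moreover have "i + n - 1 + 1 = i + n" using n by simp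
  ultimately have "(i + 2) mod n = i" using i(1) by simp
  then show False using n i(1) by (auto simp: mod_if split: if_splits)
qed

lemma root_claim_const:
  assumes u: "u \<in> verts G" and w: "w \<in> verts G"
  shows "root_claim ident cert (tree_rel G) s u = root_claim ident cert (tree_rel G) s w"
proof -
  have "(u, w) \<in> (adj (edges G))\<^sup>*"
    using valid u w by (simp add: valid_lgraph_def connected_graph_def)
  then show ?thesis
  proof induction
    case (step y z)
    then have "y \<in> verts G" using edge_verts by (auto simp: adj_def)
    then show ?case using ok[of y] step by (auto simp: local_ok_def)
  qed simp
qed

text \<open>A root is its own ancestor, so it claims its own identity; all claims agree and
  identities are injective.\<close>

lemma flag_unique:
  assumes "u \<in> verts G" "w \<in> verts G" "flag (cert u)" "flag (cert w)"
  shows "u = w"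
proof -
  have "ident u = ident w"
    using root_claim_const[OF assms(1,2)] assms
    by (simp add: root_claim_def up_flag)
  then show ?thesis using ids assms by (auto simp: id_assignment_def inj_on_def)
qed

lemma up_connected: "v \<in> verts G \<Longrightarrow> (v, up i v) \<in> (adj tree_edges)\<^sup>*"
proof (induction i)
  case (Suc i)
  let ?y = "up i v"
  have y: "?y \<in> verts G" using up_verts Suc.prems .
  have "(?y, par ?y) \<in> (adj tree_edges)\<^sup>*"
  proof (cases "par ?y = ?y")
    case False
    then have "(?y, par ?y) \<in> tree_rel G"
      using parent_mem_parents[of cert "tree_rel G" ?y] by (auto simp: parents_def)
    then show ?thesis using tree_edges_iff[OF y] by (auto simp: adj_def)
  qed simp
  then show ?case using Suc by simp
qed simp

text \<open>Any two vertices climb along labelled edges to the same root, which gives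
  connectedness.\<close>

lemma local_ok_imp_ST: "ST G"
proof -
  have "(u, w) \<in> (adj tree_edges)\<^sup>*" if u: "u \<in> verts G" and w: "w \<in> verts G" for u w
  proof -
    obtain i j where "flag (cert (up i u))" "flag (cert (up j w))"
      using up_reaches_flag u w by blast
    then have eq: "up i u = up j w" using flag_unique up_verts u w by blast
    have "sym ((adj tree_edges)\<^sup>*)"
      by (intro sym_rtrancl) (auto simp: sym_def adj_def insert_commute)
    then show ?thesis
      using up_connected[OF u, of i] up_connected[OF w, of j] eq
      by (metis rtrancl_trans symE)
  qed
  moreover have "tree_edges \<subseteq> edges G" "verts G \<noteq> {}"
    using valid by (auto simp: valid_lgraph_def connected_graph_def)
  ultimately show ?thesis
    using no_cycle by (auto simp: ST_def spanning_tree_def connected_graph_def)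
qed

end

section \<open>Completeness\<close>

context
  fixes \<rho> :: 'v and s q :: nat
  assumes st: "ST G" and \<rho>: "\<rho> \<in> verts G" and s: "s \<ge> 1"
    and q_card: "card (verts G) \<le> 2 ^ (s * q)" and q_id: "ident \<rho> < 2 ^ (s * q)"
begin

definition depth :: "'v \<Rightarrow> nat" where "depth = tdist tree_edges \<rho>"

definition tree_cert :: "'v \<Rightarrow> certificate" where
  "tree_cert v = depth_cert s q (ident \<rho>) (depth v)"

abbreviation (input) "tpar \<equiv> parent tree_cert (tree_rel G)"
abbreviation (input) "tup \<equiv> anc tree_cert (tree_rel G)"

lemma acyclic_tree_edges: "\<nexists>xs. cycle tree_edges xs"
  using st by (simp add: ST_def spanning_tree_def)

lemma tree_edges_reach: "v \<in> verts G \<Longrightarrow> (\<rho>, v) \<in> (adj tree_edges)\<^sup>*"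
  using st \<rho> by (simp add: ST_def spanning_tree_def connected_graph_def)

lemma tree_rel_adj: "u \<in> verts G \<Longrightarrow> (u, w) \<in> tree_rel G \<longleftrightarrow> (u, w) \<in> adj tree_edges"
  using tree_edges_iff[of u w] by (simp add: adj_def)

lemma tree_rel_verts: "u \<in> verts G \<Longrightarrow> (u, w) \<in> tree_rel G \<Longrightarrow> w \<in> verts G \<and> u \<noteq> w"
  using tree_rel_edge[of u w] edge_verts by (auto simp: adj_def)

lemma depth_edge:
  assumes u: "u \<in> verts G" and uw: "(u, w) \<in> tree_rel G"
  shows "depth w = Suc (depth u) \<or> depth u = Suc (depth w)"
proof -
  have e: "(u, w) \<in> adj tree_edges" and w: "w \<in> verts G" "u \<noteq> w"
    using tree_rel_adj[OF u] uw tree_rel_verts[OF u uw] by auto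
  have "depth w \<le> Suc (depth u)" "depth u \<le> Suc (depth w)"
    using tdist_step[OF tree_edges_reach[OF u] e] tdist_step[OF tree_edges_reach[OF w(1)] adj_sym[OF e]]
    by (auto simp: depth_def)
  moreover have "depth u \<noteq> depth w"
    using tdist_edge_neq[OF acyclic_tree_edges e w(2) tree_edges_reach[OF u]] by (simp add: depth_def)
  ultimately show ?thesis by linarith
qed

lemma depth_0: "v \<in> verts G \<Longrightarrow> depth v = 0 \<longleftrightarrow> v = \<rho>"
  unfolding depth_def by (rule tdist_0[OF tree_edges_reach])

text \<open>The ends of a tree edge differ in depth by exactly one, and +1 and -1 are distinct
  modulo 3.\<close>

lemma tree_parents:
  assumes v: "v \<in> verts G"
  shows "parents tree_cert (tree_rel G) v = {y. (v, y) \<in> tree_rel G \<and> depth v = Suc (depth y)}"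
proof -
  have "(depth y mod 3 + 1) mod 3 = depth v mod 3 mod 3 \<longleftrightarrow> depth v = Suc (depth y)"
    if "(v, y) \<in> tree_rel G" for y
    using depth_edge[OF v that] by (auto simp: mod_Suc split: if_splits)
  then show ?thesis unfolding parents_def tree_cert_def depth_cert_simps by blast
qed

lemma tree_parents_root: "parents tree_cert (tree_rel G) \<rho> = {}"
  using depth_0[OF \<rho>] by (simp add: tree_parents[OF \<rho>])

lemma tree_parents_singleton:
  assumes v: "v \<in> verts G" and ne: "v \<noteq> \<rho>"
  shows "is_singleton (parents tree_cert (tree_rel G) v)"
proof -
  obtain k where k: "depth v = Suc k" using depth_0[OF v] ne by (cases "depth v") auto
  obtain y where y: "(y, v) \<in> adj tree_edges" "depth y = k"
    using tdist_Suc[OF tree_edges_reach[OF v], of k] k by (metis depth_def)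
  have "parents tree_cert (tree_rel G) v = {y}"
  proof (intro equalityI subsetI)
    fix z assume "z \<in> parents tree_cert (tree_rel G) v"
    then have "(v, z) \<in> adj tree_edges" "depth v = Suc (depth z)"
      using tree_rel_adj[OF v] by (auto simp: tree_parents[OF v])
    then show "z \<in> {y}"
      using tdist_parent_unique[OF acyclic_tree_edges tree_edges_reach[OF v], of z y] y adj_sym[OF y(1)] k
      by (auto simp: depth_def)
  next
    fix z assume "z \<in> {y}"
    then show "z \<in> parents tree_cert (tree_rel G) v"
      using y k adj_sym tree_rel_adj[OF v] by (auto simp: tree_parents[OF v])
  qed
  then show ?thesis by simp
qed

text \<open>Truncated subtraction covers the root, which is its own \<open>parent\<close> at depth
  0.\<close>

lemma tree_parent:
  assumes v: "v \<in> verts G"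
  shows "tpar v \<in> verts G \<and> depth (tpar v) = depth v - 1"
proof (cases "v = \<rho>")
  case True
  then have "tpar v = v" by (simp add: parent_def tree_parents_root is_singleton_def)
  moreover have "depth v = 0" using depth_0[OF v] True by blast
  ultimately show ?thesis using v by simp
next
  case False
  then have "tpar v \<in> parents tree_cert (tree_rel G) v"
    using parents_singleton[OF tree_parents_singleton[OF v False]] by blast
  then have "(v, tpar v) \<in> tree_rel G" "depth v = Suc (depth (tpar v))"
    unfolding tree_parents[OF v] by blast+
  then show ?thesis using tree_rel_verts[OF v] by simp
qed

lemma tree_up: "v \<in> verts G \<Longrightarrow> tup i v \<in> verts G \<and> depth (tup i v) = depth v - i"
  by (induction i) (simp_all add: tree_parent)

lemma tree_up_cert: "v \<in> verts G \<Longrightarrow> tree_cert (tup i v) = depth_cert s q (ident \<rho>) (depth v - i)"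
  by (simp add: tree_cert_def tree_up)

text \<open>The ancestors of \<open>v\<close> realise every depth from 0 to
  \<open>depth v\<close>.\<close>

lemma depth_less_card:
  assumes v: "v \<in> verts G" shows "depth v < card (verts G)"
proof -
  have "d \<in> depth ` verts G" if "d \<le> depth v" for d
    using tree_up[OF v, of "depth v - d"] that by (intro image_eqI) auto
  then have "card {0..depth v} \<le> card (depth ` verts G)"
    by (intro card_mono) (auto simp: finite_verts)
  also have "\<dots> \<le> card (verts G)" by (rule card_image_le[OF finite_verts])
  finally show ?thesis by simp
qed

text \<open>Writing the depth as \<open>a + (s - 1)\<close> ensures that the window does not run
  past the root and repeat it.\<close>

lemma tree_window:
  assumes v: "v \<in> verts G" and d: "depth v = a + (s - 1)"
  shows "window tree_cert (tree_rel G) s v = map (depth_cert s q (ident \<rho>)) [a..<a + s]"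
  unfolding window_def tree_up_cert[OF v] d
  by (rule nth_equalityI) (auto simp: rev_nth)

text \<open>Such a \<open>v\<close> is the last node of segment \<open>k\<close>, so its window is
  exactly that segment. The number fits into the pieces since \<open>k\<close> is at most the depth,
  hence below the number of vertices.\<close>

lemma tree_counter:
  assumes v: "v \<in> verts G" and d: "depth v = k * s + (s - 1)"
  shows "counter tree_cert (tree_rel G) s v = k"
proof -
  have "k \<le> k * s" using s by simp
  then have "k < 2 ^ (s * q)" using d depth_less_card[OF v] q_card by linarith
  then show ?thesis
    by (simp add: counter_def tree_window[OF v d] comp_def counter_pieces[OF s] pieces_value_piece)
qed

lemma tree_root_claim:
  assumes v: "v \<in> verts G"
  shows "root_claim ident tree_cert (tree_rel G) s v = ident \<rho>"
proof (cases "depth v \<le> s - 1")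
  case True
  then have "tup (s - 1) v = \<rho>" using tree_up[OF v, of "s - 1"] depth_0 by fastforce
  moreover have "flag (tree_cert \<rho>)" using depth_0[OF \<rho>] by (simp add: tree_cert_def)
  ultimately show ?thesis by (simp add: root_claim_def)
next
  case False
  then have d: "depth v = (depth v - (s - 1)) + (s - 1)" by simp
  have "\<not> flag (tree_cert (tup (s - 1) v))" using False by (simp add: tree_up_cert[OF v])
  then show ?thesis
    using q_id by (simp add: root_claim_def tree_window[OF v d] realign_depth_cert[OF s]
        pieces_value_piece)
qed

lemma tree_local_ok:
  assumes v: "v \<in> verts G"
  shows "local_ok ident (adj (edges G)) (tree_rel G) tree_cert s v"
  unfolding local_ok_def
proof (intro conjI allI impI)
  show "colour (tree_cert y) mod 3 \<noteq> colour (tree_cert v) mod 3" if "(v, y) \<in> tree_rel G" for y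
    using depth_edge[OF v that] by (auto simp: tree_cert_def mod_Suc split: if_splits)
  show "if flag (tree_cert v) then parents tree_cert (tree_rel G) v = {}
        else is_singleton (parents tree_cert (tree_rel G) v)"
    using depth_0[OF v] tree_parents_root tree_parents_singleton[OF v] by (auto simp: tree_cert_def)
  show "root_claim ident tree_cert (tree_rel G) s y = root_claim ident tree_cert (tree_rel G) s v"
    if "(v, y) \<in> adj (edges G)" for y
    using that edge_verts v by (simp add: tree_root_claim adj_def)
  assume "\<not> flag (tree_cert (tup (2 * s - 2) v))"
  then have deep: "depth v \<ge> 2 * s - 1" by (simp add: tree_up_cert[OF v])
  \<comment> \<open>Climbing \<open>depth v mod s\<close> steps leads to the first node of the
    current segment.\<close>
  have "s dvd depth v - depth v mod s" by (simp add: minus_mod_eq_mult_div)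
  then show "\<exists>i<s. mark (tree_cert (tup i v))"
    using s by (intro exI[of _ "depth v mod s"]) (simp add: tree_up_cert[OF v])
  assume "mark (tree_cert (tup (s - 1) v))"
  then have "s dvd depth v - (s - 1)" by (simp add: tree_up_cert[OF v])
  then obtain k where "depth v - (s - 1) = s * k" by blast
  then have k: "depth v = k * s + (s - 1)" using deep by (simp add: mult.commute)
  \<comment> \<open>A depth of at least \<open>2 * s - 1\<close> leaves room for a complete
    preceding segment, with number \<open>k'\<close>.\<close>
  have "k \<noteq> 0" using k deep s by (cases k) auto
  then obtain k' where k': "k = Suc k'" using not0_implies_Suc by blast
  have "depth v - (2 * s - 1) = k' * s" "depth v - s = k' * s + (s - 1)"
    using k k' s by auto
  then show "mark (tree_cert (tup (2 * s - 1) v))"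
    and "counter tree_cert (tree_rel G) s (tup s v) < counter tree_cert (tree_rel G) s v"
    using tree_up[OF v, of s] tree_counter[OF v k] tree_counter[of "tup s v" k'] k'
    by (auto simp: tree_up_cert[OF v])
qed

end

end

section \<open>Length of the certificates and assembly of the scheme\<close>

lemma card_verts_pos: "valid_lgraph c' G \<Longrightarrow> card (verts G) \<ge> 1"
  by (simp add: valid_lgraph_def simple_graph_def connected_graph_def Suc_le_eq card_gt_0_iff)

lemma accepted_proof_exists:
  assumes "valid_lgraph c' G" "id_assignment c G ident" "ST G" "r \<ge> 1" "c \<ge> 1"
    and q: "real (card (verts G)) powr c < 2 ^ (half r * q)"
  shows "\<exists>cert. \<forall>v\<in>verts G. length (cert v) = 4 + 2 * q \<and> verifier r (view_of G ident cert r v)"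
proof -
  let ?n = "card (verts G)"
  obtain \<rho> where \<rho>: "\<rho> \<in> verts G"
    using assms(1) by (auto simp: valid_lgraph_def connected_graph_def)
  have "1 \<le> ?n" using assms(1) by (rule card_verts_pos)
  \<comment> \<open>As \<open>c \<ge> 1\<close>, the piece length chosen for identities also
    suffices for the segment numbers.\<close>
  then have "real ?n powr 1 \<le> real ?n powr c" using \<open>c \<ge> 1\<close> by (intro powr_mono) auto
  then have "real ?n \<le> real ?n powr c" by simp
  then have "real ?n < 2 ^ (half r * q)" using q by (rule le_less_trans)
  then have n: "?n \<le> 2 ^ (half r * q)"
    using of_nat_less_iff[of ?n "2 ^ (half r * q)", where 'a = real] by simp
  have "real (ident \<rho>) < 2 ^ (half r * q)"
    using assms(2) \<rho> unfolding id_assignment_def by (blast intro: le_less_trans[OF _ q])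
  then have i: "ident \<rho> < 2 ^ (half r * q)"
    using of_nat_less_iff[of "ident \<rho>" "2 ^ (half r * q)", where 'a = real] by simp
  have s: "half r \<ge> 1" using \<open>r \<ge> 1\<close> by (simp add: half_def)
  note g = assms(1,2)
  show ?thesis
    using tree_local_ok[OF g assms(3) \<rho> s n i] verifier_view[OF g _ \<open>r \<ge> 1\<close>]
    by (intro exI[of _ "tree_cert G ident \<rho> (half r) q"]) (simp add: tree_cert_def[OF g assms(3) \<rho> s n i])
qed

text \<open>The extra 1 in the piece length makes the inequality strict even when the quotient is an
  integer.\<close>

lemma powr_less_two_power:
  fixes c :: real
  assumes "n \<ge> 1" "s \<ge> 1"
  shows "real n powr c < 2 ^ (s * (nat \<lceil>c * log 2 n / s\<rceil> + 1))"
proof -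
  let ?q = "nat \<lceil>c * log 2 n / s\<rceil> + 1"
  have "c * log 2 n / s < real ?q" by linarith
  then have "c * log 2 n < real (s * ?q)"
    using assms(2) by (simp add: pos_divide_less_eq mult.commute distrib_left)
  then have "2 powr (c * log 2 n) < 2 powr real (s * ?q)" by simp
  moreover have "2 powr (c * log 2 n) = real n powr c"
    using assms(1) by (simp add: mult.commute[of c] flip: powr_powr)
  ultimately show ?thesis by (simp only: powr_realpow)
qed

text \<open>The assumption that \<open>t\<close> is logarithmically bounded absorbs the constant
  overhead of flag, mark, colour and rounding.\<close>

lemma piece_length_bigo:
  fixes t :: "nat \<Rightarrow> nat" and c :: real
  assumes c: "c \<ge> 1" and t1: "\<And>n. n \<ge> 1 \<Longrightarrow> t n \<ge> 1"
    and t: "(\<lambda>n. real (t n)) \<in> O(\<lambda>n. ln (real n))"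
  shows "(\<lambda>n. real (4 + 2 * (nat \<lceil>c * log 2 n / half (t n)\<rceil> + 1))) \<in> O(\<lambda>n. ln (real n) / real (t n))"
proof -
  obtain C where C: "\<forall>\<^sub>F n in sequentially. norm (real (t n)) \<le> C * norm (ln (real n))"
    using t by (auto simp: bigo_def)
  show ?thesis
  proof (rule bigoI)
    show "\<forall>\<^sub>F n in sequentially.
        norm (real (4 + 2 * (nat \<lceil>c * log 2 n / half (t n)\<rceil> + 1)))
        \<le> (8 * C + 4 * c / ln 2) * norm (ln (real n) / real (t n))"
      using C eventually_ge_at_top[of 1]
    proof eventually_elim
      case (elim n)
      let ?x = "ln (real n) / real (t n)"
      have t0: "real (t n) \<ge> 1" using t1[OF elim(2)] by simp
      have ln0: "ln (real n) \<ge> 0" using elim(2) by simp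
      have s: "real (half (t n)) \<ge> real (t n) / 2"
        unfolding half_def by linarith
      have "c * log 2 n / half (t n) \<le> c * log 2 n / (real (t n) / 2)"
        using s t0 c ln0 by (intro divide_left_mono mult_nonneg_nonneg mult_pos_pos) (auto simp: log_def)
      also have "\<dots> = 2 * c / ln 2 * ?x" by (simp add: log_def field_simps)
      finally have le: "c * log 2 n / half (t n) \<le> 2 * c / ln 2 * ?x" .
      have "0 \<le> c * log 2 n / half (t n)" using c ln0 by (auto simp: log_def)
      then have "real (nat \<lceil>c * log 2 n / half (t n)\<rceil>) \<le> c * log 2 n / half (t n) + 1"
        by linarith
      then have "real (4 + 2 * (nat \<lceil>c * log 2 n / half (t n)\<rceil> + 1))
          \<le> 8 + 2 * (c * log 2 n / half (t n))" by simp
      also have "\<dots> \<le> 8 * (C * ?x) + 2 * (2 * c / ln 2 * ?x)"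
      proof -
        \<comment> \<open>This is \<open>t n \<le> C * ln n\<close> divided by \<open>t n\<close>;
          it bounds the additive 8 by \<open>8 * C * ?x\<close>.\<close>
        have "1 \<le> C * ?x" using elim(1) t0 ln0 by (simp add: field_simps)
        then show ?thesis using le by linarith
      qed
      also have "\<dots> = (8 * C + 4 * c / ln 2) * ?x" by (simp add: algebra_simps)
      finally show ?case using ln0 t0 by simp
    qed
  qed
qed

theorem theorem19:
  fixes t :: "nat \<Rightarrow> nat" and c c' :: real
  assumes "c \<ge> 1" and "c' \<ge> 1"
    and "\<And>n. n \<ge> 1 \<Longrightarrow> t n \<ge> 1"
    and "(\<lambda>n. real (t n)) \<in> O(\<lambda>n. ln (real n))"
  shows "\<exists>b :: nat \<Rightarrow> nat.
    (\<lambda>n. real (b n)) \<in> O(\<lambda>n. ln (real n) / real (t n)) \<and>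
    (\<forall>n. size_pls c c' (ST :: 'v lgraph \<Rightarrow> bool) t n \<le> enat (b n)) \<and>
    (\<exists>(prv :: 'v prover) ver. pls c c' ST t prv ver \<and>
       (\<forall>n. pls_size c c' ST prv n \<le> enat (b n)))"
proof -
  define q where "q = (\<lambda>n. nat \<lceil>c * log 2 (real n) / real (half (t n))\<rceil> + 1)"
  define b where "b = (\<lambda>n. 4 + 2 * q n)"
  define good where "good = (\<lambda>(G :: 'v lgraph) ident cert. \<forall>v\<in>verts G.
    length (cert v) = b (card (verts G)) \<and>
    verifier (t (card (verts G))) (view_of G ident cert (t (card (verts G))) v))"
  \<comment> \<open>The choice absorbs the arbitrary selection of a root; on instances outside
    \<open>ST\<close> its value is irrelevant.\<close>
  define prv :: "'v prover" where "prv = (\<lambda>G ident. SOME cert. good G ident cert)"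
  have good: "good G ident (prv G ident)"
    if "valid_lgraph c' G" "id_assignment c G ident" "ST G" for G :: "'v lgraph" and ident
  proof -
    note n = card_verts_pos[OF that(1)]
    have r: "t (card (verts G)) \<ge> 1" using assms(3) n by blast
    then have "half (t (card (verts G))) \<ge> 1" by (simp add: half_def)
    from accepted_proof_exists[OF that r assms(1) powr_less_two_power[OF n this]]
    have "\<exists>cert. good G ident cert" by (simp add: good_def b_def q_def)
    then show ?thesis unfolding prv_def by (rule someI_ex)
  qed
  have pls: "pls c c' ST t prv verifier"
    unfolding pls_def Let_def
  proof (intro allI impI conjI)
    fix G :: "'v lgraph" and ident cert
    assume g: "valid_lgraph c' G \<and> id_assignment c G ident"
    let ?r = "t (card (verts G))"
    have r: "?r \<ge> 1" using assms(3) card_verts_pos g by blast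
    show "\<forall>v\<in>verts G. verifier ?r (view_of G ident (prv G ident) ?r v)" if "ST G"
      using good that g by (auto simp: good_def)
    show "\<exists>v\<in>verts G. \<not> verifier ?r (view_of G ident cert ?r v)" if "\<not> ST G"
    proof (rule ccontr)
      assume "\<not> ?thesis"
      then have "local_ok ident (adj (edges G)) (tree_rel G) cert (half ?r) v" if "v \<in> verts G" for v
        using verifier_view[of c' G c ident v ?r cert] g r that by blast
      moreover have "half ?r \<ge> 1" using r by (simp add: half_def)
      ultimately show False using local_ok_imp_ST[of c' G c ident "half ?r" cert] g that by blast
    qed
  qed
  have size: "pls_size c c' ST prv n \<le> enat (b n)" for n
    unfolding pls_size_def
    using good by (intro Sup_least) (auto simp: good_def)
  have "size_pls c c' (ST :: 'v lgraph \<Rightarrow> bool) t n \<le> enat (b n)" for n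
    unfolding size_pls_def using pls by (intro Inf_lower2[OF _ size]) blast
  moreover have "(\<lambda>n. real (b n)) \<in> O(\<lambda>n. ln (real n) / real (t n))"
    using piece_length_bigo[OF assms(1,3,4)] by (simp add: b_def q_def)
  ultimately show ?thesis using pls size by blast
qed

end
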